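(* Let $P\subset\mathbb{R}^d$ be a $d$-dimensional convex polytope. For each direction $u\in\mathbb{S}^{d-1}$ there exists a partial order on the set consisting of all vertices of $P$ together with all edges of $P$ that are not orthogonal to $u$, such that for every hyperplane $H$ with normal vector $u$ and $H\cap P\ne\emptyset$, the set of those elements (vertices and edges) that are intersected by $H$ is a maximal antichain (maximal with respect to inclusion) in this partially ordered set.
   Context: A vertex $v$ of $P$ is intersected by $H$ if $v\in H$. An edge of $P$ not orthogonal to $u$ is intersected by $H$ if $H$ meets the edge in a point of its relative interior. An edge with endpoints $v,w$ is orthogonal to $u$ if $u\cdot(v-w)=0$. The partial order depends on $P$ and $u$ but not on $H$. *)

theory Defs
  imports "HOL-Analysis.Analysis"
begin

definition edge_orthogonal :: "'a::euclidean_space \<Rightarrow> 'a set \<Rightarrow> bool" where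
  "edge_orthogonal u e \<longleftrightarrow> (\<exists>v w. e = closed_segment v w \<and> u \<bullet> (v - w) = 0)"

text \<open>
  Vertices are tagged by \<^const>\<open>Inl\<close>, edges by \<^const>\<open>Inr\<close>. An edge is represented by
  the closed segment it occupies.
\<close>

definition vertices_edges :: "'a::euclidean_space set \<Rightarrow> 'a \<Rightarrow> ('a + 'a set) set" where
  "vertices_edges P u =
     Inl ` {v. v extreme_point_of P} \<union> Inr ` {e. e edge_of P \<and> \<not> edge_orthogonal u e}"

fun intersected :: "'a::euclidean_space set \<Rightarrow> 'a + 'a set \<Rightarrow> bool" where
  "intersected H (Inl v) \<longleftrightarrow> v \<in> H"
| "intersected H (Inr e) \<longleftrightarrow> H \<inter> rel_interior e \<noteq> {}"

text \<open>In the following, \<open>r\<close> is a non-strict (reflexive) order relation on \<open>A\<close>.\<close>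

definition antichain_on :: "'b set \<Rightarrow> ('b \<times> 'b) set \<Rightarrow> 'b set \<Rightarrow> bool" where
  "antichain_on A r S \<longleftrightarrow> S \<subseteq> A \<and> (\<forall>x\<in>S. \<forall>y\<in>S. (x, y) \<in> r \<longrightarrow> x = y)"

definition maximal_antichain_on :: "'b set \<Rightarrow> ('b \<times> 'b) set \<Rightarrow> 'b set \<Rightarrow> bool" where
  "maximal_antichain_on A r S \<longleftrightarrow>
     antichain_on A r S \<and> (\<forall>T. antichain_on A r T \<and> S \<subseteq> T \<longrightarrow> T = S)"

end

theory Submission
  imports Defs
begin

text \<open>
  Every element of the poset occupies a set of heights, measured by the functional \<open>inner u\<close>: a
  single number for a vertex, an open interval for an edge that is not orthogonal to \<open>u\<close>. The
  hyperplane at height \<open>c\<close> intersects exactly the elements whose height set contains \<open>c\<close>. The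
  order that works is the interval order: \<open>x\<close> is below \<open>y\<close> if every height of \<open>x\<close> is smaller than
  every height of \<open>y\<close>. Two elements that share the height \<open>c\<close> are then incomparable, so the
  intersected elements form an antichain.

  For maximality, let \<open>y\<close> miss the hyperplane; height sets are intervals, so \<open>y\<close> lies strictly on one
  side, say above it. An intersected element below \<open>y\<close> is needed, and an arbitrary one will not do,
  because an intersected edge may reach higher than the bottom of \<open>y\<close>. If the vertex at the bottom
  of \<open>y\<close> lies on the hyperplane, it serves. Otherwise consider the lowest vertex \<open>w\<close> above height
  \<open>c\<close> (\<open>intersected_element_below\<close>). Since the hyperplane meets the polytope, \<open>w\<close> does not minimise the height, so, as in the simplex algorithm, some edge
  descends from \<open>w\<close>. Its other end has height at most \<open>c\<close> by the choice of \<open>w\<close>; so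
  either that end or the edge itself is intersected, and neither rises above \<open>w\<close>, which is no
  higher than the bottom of \<open>y\<close>. The case of \<open>y\<close> below the hyperplane is the same with
  \<open>- u\<close> in place of \<open>u\<close>.

  The existence of a descending edge (\<open>descending_edge\<close>) is proved with a vertex figure. Cut \<open>w\<close> off
  from the remaining vertices by a hyperplane. The slice contains a point lower than \<open>w\<close>,
  hence an extreme point lower than \<open>w\<close>, and extreme points of a slice that
  avoids the vertices lie on edges (\<open>extreme_point_of_Int_hyperplane_in_low_face\<close>).
\<close>

section \<open>Edges of a polytope\<close>

lemma edge_of_polytope_is_segment:
  fixes P :: "'a::euclidean_space set"
  assumes "polytope P" "e edge_of P"
  obtains a b where "e = closed_segment a b" "a \<noteq> b" "a extreme_point_of P" "b extreme_point_of P"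
proof -
  have face: "e face_of P" and dim: "aff_dim e = 1"
    using assms(2) by (auto simp: edge_of_def)
  have "polytope e"
    using assms(1) face face_of_polytope_polytope by blast
  then have "compact e" "convex e"
    by (auto simp: polytope_imp_compact polytope_imp_convex)
  moreover have "e \<noteq> {}" "collinear e"
    using dim by (auto simp: collinear_aff_dim)
  ultimately obtain a b where e: "e = closed_segment a b"
    using compact_convex_collinear_segment by blast
  have "a \<noteq> b"
    using dim e by auto
  moreover have "a extreme_point_of P" "b extreme_point_of P"
    using extreme_point_of_face[OF face] extreme_point_of_segment unfolding e by blast+
  ultimately show thesis
    using that e by blast
qed

text \<open>
  If the smallest face around an extreme point of the slice had dimension at least two, its
  intersection with the hyperplane would still contain a segment around that point.
\<close>

lemma extreme_point_of_Int_hyperplane_in_low_face: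
  fixes P :: "'a::euclidean_space set"
  assumes "polytope P" and q: "q extreme_point_of (P \<inter> {x. a \<bullet> x = b})"
  obtains F where "F face_of P" "q \<in> rel_interior F" "aff_dim F \<le> 1"
proof -
  have "q \<in> P" and qH: "a \<bullet> q = b"
    using q by (auto simp: extreme_point_of_def)
  have "\<exists>F. F face_of P \<and> q \<in> F"
    using \<open>q \<in> P\<close> assms(1) face_of_refl polytope_imp_convex by blast
  then obtain F where F: "F face_of P" "q \<in> F"
    and least: "\<And>G. G face_of P \<and> q \<in> G \<Longrightarrow> nat (aff_dim F + 1) \<le> nat (aff_dim G + 1)"
    using ex_has_least_nat[of "\<lambda>F. F face_of P \<and> q \<in> F" _ "\<lambda>F. nat (aff_dim F + 1)"] by metis
  have poly: "polytope F"
    using assms(1) F(1) face_of_polytope_polytope by blast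
  have rel: "q \<in> rel_interior F"
  proof (rule ccontr)
    assume "q \<notin> rel_interior F"
    then have "q \<in> rel_frontier F"
      using F(2) closure_subset by (auto simp: rel_frontier_def)
    then obtain G where G: "G face_of F" "G \<noteq> F" "q \<in> G"
      using rel_frontier_of_polyhedron_alt[OF polytope_imp_polyhedron[OF poly]] by auto
    then have "aff_dim G < aff_dim F"
      using face_of_aff_dim_lt poly polytope_imp_convex by blast
    moreover have "aff_dim G \<ge> -1"
      by (rule aff_dim_geq)
    ultimately show False
      using least[of G] face_of_trans[OF G(1) F(1)] G(3) by linarith
  qed
  define A where "A = affine hull F \<inter> {x. a \<bullet> x = b}"
  have "q \<in> A"
    using F(2) qH by (auto simp: A_def hull_inc)
  have "affine A"
    unfolding A_def by (intro affine_Int affine_affine_hull affine_hyperplane)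
  obtain r where r: "r > 0" "ball q r \<inter> affine hull F \<subseteq> F"
    using rel by (auto simp: mem_rel_interior_ball)
  have slice: "A \<inter> ball q r \<subseteq> P \<inter> {x. a \<bullet> x = b}"
    using r(2) face_of_imp_subset[OF F(1)] by (auto simp: A_def)
  \<comment> \<open>A further point of the slice near \<open>q\<close> and its reflection in \<open>q\<close> would have the extreme
    point \<open>q\<close> as their midpoint.\<close>
  have "A \<inter> ball q r \<subseteq> {q}"
  proof
    fix x assume x: "x \<in> A \<inter> ball q r"
    define y where "y = 2 *\<^sub>R q - x"
    have "y \<in> A"
      using \<open>affine A\<close> \<open>q \<in> A\<close> x mem_affine[of A q x 2 "-1"] by (auto simp: y_def)
    moreover have "y \<in> ball q r"
      using x by (simp add: y_def dist_norm scaleR_2 norm_minus_commute)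
    ultimately have xy: "x \<in> P \<inter> {x. a \<bullet> x = b}" "y \<in> P \<inter> {x. a \<bullet> x = b}"
      using slice x by auto
    show "x \<in> {q}"
    proof (rule ccontr)
      assume "x \<notin> {q}"
      moreover have mid: "q = midpoint x y"
        by (simp add: y_def midpoint_def)
      ultimately have "x \<noteq> y"
        by auto
      then have "q \<in> open_segment x y"
        unfolding mid by (simp add: midpoint_in_open_segment)
      then show False
        using q xy by (auto simp: extreme_point_of_def)
    qed
  qed
  then have "aff_dim (A \<inter> ball q r) \<le> 0"
    by (metis aff_dim_sing aff_dim_subset)
  moreover have "affine hull (A \<inter> ball q r) = affine hull A"
    using \<open>affine A\<close> \<open>q \<in> A\<close> r(1) by (intro affine_hull_affine_Int_open) auto
  ultimately have "aff_dim A \<le> 0"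
    by (metis aff_dim_affine_hull)
  then have "aff_dim F \<le> 1"
    using \<open>q \<in> A\<close> aff_dim_affine_Int_hyperplane[of "affine hull F" a b]
    by (auto simp: A_def split: if_splits)
  with F(1) rel that show thesis
    by blast
qed

lemma descending_edge:
  fixes P :: "'a::euclidean_space set"
  assumes P: "polytope P" and w: "w extreme_point_of P" and p: "p \<in> P" "u \<bullet> p < u \<bullet> w"
  obtains v where "v extreme_point_of P" "closed_segment v w edge_of P" "u \<bullet> v < u \<bullet> w"
proof -
  define V where "V = {v. v extreme_point_of P}"
  have "finite V"
    unfolding V_def using P finite_polyhedron_extreme_points polytope_imp_polyhedron by blast
  have hullV: "P = convex hull V"
    unfolding V_def
    using P Krein_Milman_Minkowski polytope_imp_compact polytope_imp_convex by blast
  have "w \<notin> convex hull (V - {w})"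
  proof
    assume "w \<in> convex hull (V - {w})"
    moreover have "convex hull (V - {w}) \<subseteq> P"
      unfolding hullV by (rule hull_mono) auto
    ultimately have "w extreme_point_of (convex hull (V - {w}))"
      using w by (auto simp: extreme_point_of_def)
    then show False
      using extreme_point_of_convex_hull by blast
  qed
  moreover have "closed (convex hull (V - {w}))"
    using \<open>finite V\<close> by (simp add: compact_imp_closed finite_imp_compact_convex_hull)
  ultimately obtain a b where ab: "a \<bullet> w < b" "\<And>x. x \<in> convex hull (V - {w}) \<Longrightarrow> b < a \<bullet> x"
    using separating_hyperplane_closed_point[of "convex hull (V - {w})" w]
    by auto
  have abV: "b < a \<bullet> v" if "v extreme_point_of P" "v \<noteq> w" for v
    using that ab(2)[of v] by (auto simp: V_def hull_inc)
  \<comment> \<open>The slice has a point lower than \<open>w\<close>: some vertex is lower, and the segment from \<open>w\<close> to it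
    crosses the cutting hyperplane.\<close>
  obtain v0 where v0: "v0 extreme_point_of P" "u \<bullet> v0 < u \<bullet> w"
  proof (rule ccontr)
    assume "\<not> thesis"
    then have "V \<subseteq> {x. u \<bullet> w \<le> u \<bullet> x}"
      using that by (force simp: V_def)
    then have "P \<subseteq> {x. u \<bullet> w \<le> u \<bullet> x}"
      using hull_minimal[of V _ convex] convex_halfspace_ge[of "u \<bullet> w" u] hullV by auto
    then show False
      using p by auto
  qed
  then have "b < a \<bullet> v0"
    using abV by auto
  define H where "H = {x. a \<bullet> x = b}"
  define t where "t = (b - a \<bullet> w) / (a \<bullet> v0 - a \<bullet> w)"
  define z where "z = (1 - t) *\<^sub>R w + t *\<^sub>R v0"
  have t: "0 < t" "t < 1"
    using ab(1) \<open>b < a \<bullet> v0\<close> by (auto simp: t_def field_simps)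
  have zt: "f \<bullet> z = f \<bullet> w + t * (f \<bullet> v0 - f \<bullet> w)" for f
    by (simp add: z_def inner_add_right algebra_simps)
  have "z \<in> P"
    using w v0(1) t P polytope_imp_convex[OF P]
    by (auto simp: z_def extreme_point_of_def intro!: convexD_alt)
  moreover have "a \<bullet> z = b"
    using ab(1) \<open>b < a \<bullet> v0\<close> zt[of a] by (simp add: t_def)
  ultimately have zH: "z \<in> P \<inter> H"
    by (simp add: H_def)
  have zu: "u \<bullet> z < u \<bullet> w"
    using zt[of u] t v0(2) mult_pos_neg[of t "u \<bullet> v0 - u \<bullet> w"] by simp
  obtain q where q: "q extreme_point_of (P \<inter> H)" "u \<bullet> q < u \<bullet> w"
  proof (rule ccontr)
    assume "\<not> thesis"
    then have *: "{x. x extreme_point_of (P \<inter> H)} \<subseteq> {x. u \<bullet> w \<le> u \<bullet> x}"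
      using that by force
    have "compact (P \<inter> H)" "convex (P \<inter> H)"
      using P by (auto simp: H_def polytope_imp_compact polytope_imp_convex compact_Int_closed
          closed_hyperplane convex_Int convex_hyperplane)
    then have "P \<inter> H = convex hull {x. x extreme_point_of (P \<inter> H)}"
      by (rule Krein_Milman_Minkowski)
    also have "\<dots> \<subseteq> {x. u \<bullet> w \<le> u \<bullet> x}"
      using * by (intro hull_minimal convex_halfspace_ge)
    finally show False
      using zH zu by auto
  qed
  then have qH: "a \<bullet> q = b"
    by (simp add: extreme_point_of_def H_def)
  obtain F where F: "F face_of P" "q \<in> rel_interior F" "aff_dim F \<le> 1"
    using extreme_point_of_Int_hyperplane_in_low_face P q(1) unfolding H_def by blast
  have "q \<in> F"
    using F(2) rel_interior_subset by blast
  have "aff_dim F \<noteq> 0"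
  proof
    \<comment> \<open>No vertex lies on the cutting hyperplane.\<close>
    assume "aff_dim F = 0"
    then have "F = {q}"
      using \<open>q \<in> F\<close> by (auto simp: aff_dim_eq_0)
    then have "q extreme_point_of P"
      using F(1) by (simp add: face_of_singleton)
    then show False
      using abV[of q] ab(1) qH by (cases "q = w") auto
  qed
  moreover have "aff_dim F \<ge> 0"
    using \<open>q \<in> F\<close> aff_dim_subset[of "{q}" F] by simp
  ultimately have "F edge_of P"
    using F(1,3) by (simp add: edge_of_def)
  then obtain c d where cd: "F = closed_segment c d" "c \<noteq> d" "c extreme_point_of P" "d extreme_point_of P"
    using edge_of_polytope_is_segment P by blast
  then obtain s where s: "0 < s" "s < 1" "q = (1 - s) *\<^sub>R c + s *\<^sub>R d"
    using F(2) by (auto simp: rel_interior_closed_segment in_segment)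
  have qs: "f \<bullet> q = (1 - s) * (f \<bullet> c) + s * (f \<bullet> d)" for f
    using s(3) by (simp add: inner_add_right)
  \<comment> \<open>The edge crosses the cutting hyperplane, so one of its ends is the vertex that was cut off.\<close>
  have "c = w \<or> d = w"
  proof (rule ccontr)
    assume "\<not> (c = w \<or> d = w)"
    then have "b < a \<bullet> c" "b < a \<bullet> d"
      using abV cd by auto
    then have "(1 - s) * b + s * b < (1 - s) * (a \<bullet> c) + s * (a \<bullet> d)"
      using s by (intro add_strict_mono mult_strict_left_mono) auto
    then show False
      using qs[of a] qH by (simp add: algebra_simps)
  qed
  then show thesis
  proof
    assume "c = w"
    then have "s * (u \<bullet> d) < s * (u \<bullet> w)"
      using q(2) qs[of u] by (simp add: algebra_simps)
    then show thesis
      using that[of d] cd \<open>F edge_of P\<close> \<open>c = w\<close> s(1) by (simp add: closed_segment_commute)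
  next
    assume "d = w"
    then have "(1 - s) * (u \<bullet> c) < (1 - s) * (u \<bullet> w)"
      using q(2) qs[of u] by (simp add: algebra_simps)
    then show thesis
      using that[of c] cd \<open>F edge_of P\<close> \<open>d = w\<close> s(2) by simp
  qed
qed

section \<open>Heights of vertices and edges\<close>

fun heights :: "'a::euclidean_space \<Rightarrow> 'a + 'a set \<Rightarrow> real set" where
  "heights u (Inl v) = {u \<bullet> v}"
| "heights u (Inr e) = (\<bullet>) u ` rel_interior e"

lemma intersected_iff_heights: "intersected {x. u \<bullet> x = c} x \<longleftrightarrow> c \<in> heights u x"
  by (cases x) auto

lemma heights_uminus: "heights (- u) x = uminus ` heights u x"
  by (cases x) (auto simp: image_image)

lemma vertices_edges_uminus: "vertices_edges P (- u) = vertices_edges P u"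
  by (simp add: vertices_edges_def edge_orthogonal_def)

lemma not_edge_orthogonal_segment_iff:
  "\<not> edge_orthogonal u (closed_segment a b) \<longleftrightarrow> u \<bullet> a \<noteq> u \<bullet> b"
  by (auto simp: edge_orthogonal_def doubleton_eq_iff inner_diff_right)

lemma heights_segment:
  fixes u :: "'a::euclidean_space"
  assumes "u \<bullet> a < u \<bullet> b"
  shows "heights u (Inr (closed_segment a b)) = {u \<bullet> a <..< u \<bullet> b}"
proof -
  have "a \<noteq> b"
    using assms by auto
  moreover have "(\<bullet>) u ` open_segment a b = open_segment (u \<bullet> a) (u \<bullet> b)"
    using assms \<open>a \<noteq> b\<close>
    by (auto simp: open_segment_image_interval image_image inner_add_right)
  ultimately show ?thesis
    using assms by (simp add: rel_interior_closed_segment open_segment_eq_real_ivl)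
qed

text \<open>
  Besides the shape of the height sets, what matters is that the infimum of the heights of an
  element is the height of a vertex \<open>w\<close>, the bottom of the element: a descent can start there.
\<close>

lemma vertices_edges_cases_heights:
  assumes "polytope P" "x \<in> vertices_edges P u"
  obtains w where "w extreme_point_of P" "x = Inl w" "heights u x = {u \<bullet> w}"
  | w h where "w extreme_point_of P" "u \<bullet> w < h" "heights u x = {u \<bullet> w <..< h}"
proof (cases x)
  case (Inl v)
  then show thesis
    using assms(2) that(1) by (auto simp: vertices_edges_def)
next
  case (Inr e)
  then have e: "e edge_of P" "\<not> edge_orthogonal u e"
    using assms(2) by (auto simp: vertices_edges_def)
  then obtain a b where ab: "e = closed_segment a b" "a extreme_point_of P" "b extreme_point_of P"
    using edge_of_polytope_is_segment assms(1) by blast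
  then consider "u \<bullet> a < u \<bullet> b" | "u \<bullet> b < u \<bullet> a"
    using e(2) not_edge_orthogonal_segment_iff by fastforce
  then show thesis
  proof cases
    case 1
    then show thesis
      using that(2)[of a] ab Inr heights_segment by blast
  next
    case 2
    then show thesis
      using that(2)[of b] ab Inr heights_segment[OF 2] by (simp add: closed_segment_commute)
  qed
qed

lemma heights_nonempty:
  assumes "polytope P" "x \<in> vertices_edges P u"
  shows "heights u x \<noteq> {}"
  using assms by (rule vertices_edges_cases_heights) auto

lemma heights_is_interval:
  assumes "polytope P" "x \<in> vertices_edges P u"
  shows "is_interval (heights u x)"
  using assms by (rule vertices_edges_cases_heights) (auto simp: is_interval_1)

section \<open>The interval order\<close>

definition interval_less :: "'a::euclidean_space \<Rightarrow> 'a + 'a set \<Rightarrow> 'a + 'a set \<Rightarrow> bool" where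
  "interval_less u x y \<longleftrightarrow> (\<forall>s\<in>heights u x. \<forall>t\<in>heights u y. s < t)"

lemma interval_less_uminus: "interval_less (- u) x y \<longleftrightarrow> interval_less u y x"
  by (auto simp: interval_less_def heights_uminus)

lemma partial_order_on_interval_order:
  assumes "\<And>x. x \<in> A \<Longrightarrow> heights u x \<noteq> {}"
  shows "partial_order_on A {(x, y). x \<in> A \<and> y \<in> A \<and> (x = y \<or> interval_less u x y)}"
proof -
  have irrefl: "\<not> interval_less u x x" if "x \<in> A" for x
    using assms[OF that] by (auto simp: interval_less_def)
  have trans: "interval_less u x z" if "interval_less u x y" "interval_less u y z" "y \<in> A" for x y z
    using that assms[of y] unfolding interval_less_def by (meson all_not_in_conv less_trans)
  show ?thesis
    unfolding partial_order_on_def preorder_on_def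
  proof (intro conjI)
    show "trans {(x, y). x \<in> A \<and> y \<in> A \<and> (x = y \<or> interval_less u x y)}"
      by (rule transI) (auto intro: trans)
    show "antisym {(x, y). x \<in> A \<and> y \<in> A \<and> (x = y \<or> interval_less u x y)}"
      by (rule antisymI) (auto dest: trans irrefl)
  qed (auto simp: refl_on_def)
qed

text \<open>
  If the bottom of \<open>y\<close> is at height \<open>c\<close>, it is the witness. Otherwise, the lowest vertex above
  height \<open>c\<close> has an edge descending to height at most \<open>c\<close>. This edge, or
  its lower end if that lies exactly at height \<open>c\<close>, is the witness: it does not rise above any
  vertex that is higher than \<open>c\<close>, and in particular not above the bottom of \<open>y\<close>.
\<close>

lemma intersected_element_below:
  assumes P: "polytope P" and y: "y \<in> vertices_edges P u"
    and above: "\<And>t. t \<in> heights u y \<Longrightarrow> c < t" and p: "p \<in> P" "u \<bullet> p = c"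
  obtains x where "x \<in> vertices_edges P u" "c \<in> heights u x" "interval_less u x y"
proof -
  note element_below = that
  obtain w where w: "w extreme_point_of P" "c \<le> u \<bullet> w"
    and bottom: "\<And>t. t \<in> heights u y \<Longrightarrow> u \<bullet> w \<le> t"
  proof (rule vertices_edges_cases_heights[OF P y])
    fix w assume "w extreme_point_of P" "heights u y = {u \<bullet> w}"
    then show thesis
      using that[of w] above[of "u \<bullet> w"] by auto
  next
    fix w h assume w: "w extreme_point_of P" "u \<bullet> w < h" "heights u y = {u \<bullet> w <..< h}"
    then have "c \<le> u \<bullet> w"
      using above by (intro dense_ge_bounded[of "u \<bullet> w" h c]) (auto intro: less_imp_le)
    then show thesis
      using that[of w] w by auto
  qed
  have vertex: thesis if v: "v extreme_point_of P" "u \<bullet> v = c" for v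
  proof (rule element_below)
    show "Inl v \<in> vertices_edges P u"
      using v by (simp add: vertices_edges_def)
  qed (use v above in \<open>auto simp: interval_less_def\<close>)
  show thesis
  proof (cases "u \<bullet> w = c")
    case True
    then show thesis
      using vertex w(1) by blast
  next
    case False
    define V where "V = {v. v extreme_point_of P \<and> c < u \<bullet> v}"
    have "finite {v. v extreme_point_of P}"
      using P finite_polyhedron_extreme_points polytope_imp_polyhedron by blast
    then have "finite V"
      unfolding V_def by (rule rev_finite_subset) auto
    moreover have "w \<in> V"
      using w False by (auto simp: V_def)
    ultimately obtain m where m: "m \<in> V" "\<And>v. v \<in> V \<Longrightarrow> u \<bullet> m \<le> u \<bullet> v"
      using ex_min_if_finite[of "(\<bullet>) u ` V"]
      by (metis arg_min_if_finite(1) arg_min_least empty_iff)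
    then have m': "m extreme_point_of P" "c < u \<bullet> m" "u \<bullet> m \<le> u \<bullet> w"
      using \<open>w \<in> V\<close> by (auto simp: V_def)
    then obtain v where v: "v extreme_point_of P" "closed_segment v m edge_of P" "u \<bullet> v < u \<bullet> m"
      using descending_edge[OF P, of m p u] p by auto
    then have "u \<bullet> v \<le> c"
      using m(2)[of v] by (force simp: V_def)
    show thesis
    proof (cases "u \<bullet> v = c")
      case True
      then show thesis
        using vertex v(1) by blast
    next
      case False
      have "Inr (closed_segment v m) \<in> vertices_edges P u"
        using v by (auto simp: vertices_edges_def not_edge_orthogonal_segment_iff)
      moreover have "c \<in> heights u (Inr (closed_segment v m))"
        using heights_segment[OF v(3)] False \<open>u \<bullet> v \<le> c\<close> m'(2) by auto
      moreover have "interval_less u (Inr (closed_segment v m)) y"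
        using bottom m'(3) unfolding interval_less_def heights_segment[OF v(3)] by force
      ultimately show thesis
        using that by blast
    qed
  qed
qed

text \<open>Reflecting the height function turns \<open>intersected_element_below\<close> into its mirror image.\<close>

lemma intersected_element_above:
  assumes P: "polytope P" and y: "y \<in> vertices_edges P u"
    and below: "\<And>t. t \<in> heights u y \<Longrightarrow> t < c" and p: "p \<in> P" "u \<bullet> p = c"
  obtains x where "x \<in> vertices_edges P u" "c \<in> heights u x" "interval_less u y x"
proof (rule intersected_element_below[of P y "- u" "- c" p])
  fix x assume "x \<in> vertices_edges P (- u)" "- c \<in> heights (- u) x" "interval_less (- u) x y"
  then show thesis
    using that by (auto simp: vertices_edges_uminus heights_uminus interval_less_uminus)
qed (use assms in \<open>auto simp: vertices_edges_uminus heights_uminus\<close>)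

lemma intersected_elements_maximal_antichain:
  assumes P: "polytope P" and p: "p \<in> P" "u \<bullet> p = c"
  defines "A \<equiv> vertices_edges P u"
  shows "maximal_antichain_on A {(x, y). x \<in> A \<and> y \<in> A \<and> (x = y \<or> interval_less u x y)}
           {x \<in> A. c \<in> heights u x}"
proof -
  define r where "r = {(x, y). x \<in> A \<and> y \<in> A \<and> (x = y \<or> interval_less u x y)}"
  define S where "S = {x \<in> A. c \<in> heights u x}"
  have "antichain_on A r S"
    by (auto simp: antichain_on_def r_def S_def interval_less_def)
  moreover have "T \<subseteq> S" if T: "antichain_on A r T" "S \<subseteq> T" for T
  proof
    fix y assume "y \<in> T"
    then have y: "y \<in> A"
      using T(1) by (auto simp: antichain_on_def)
    show "y \<in> S"
    proof (rule ccontr)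
      assume "y \<notin> S"
      then have c: "c \<notin> heights u y"
        using y by (simp add: S_def)
      have "\<exists>x\<in>S. (x, y) \<in> r \<or> (y, x) \<in> r"
      proof (cases "\<forall>t\<in>heights u y. c < t")
        case True
        then obtain x where "x \<in> A" "c \<in> heights u x" "interval_less u x y"
          using intersected_element_below[OF P _ _ p, of y] y unfolding A_def by blast
        then show ?thesis
          using y by (auto simp: S_def r_def)
      next
        case False
        then obtain t0 where t0: "t0 \<in> heights u y" "t0 < c"
          using c by (metis linorder_neqE)
        have "t < c" if "t \<in> heights u y" for t
          using heights_is_interval[OF P, of y u] y t0 that c
          unfolding A_def is_interval_1 by (meson less_imp_le not_less)
        then obtain x where "x \<in> A" "c \<in> heights u x" "interval_less u y x"
          using intersected_element_above[OF P _ _ p, of y] y unfolding A_def by blast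
        then show ?thesis
          using y by (auto simp: S_def r_def)
      qed
      then show False
        using T \<open>y \<in> T\<close> \<open>y \<notin> S\<close> unfolding antichain_on_def by blast
    qed
  qed
  ultimately have "maximal_antichain_on A r S"
    by (auto simp: maximal_antichain_on_def)
  then show ?thesis
    by (simp add: r_def S_def)
qed

theorem theorem1p2:
  fixes P :: "(real ^ 'd) set" and u :: "real ^ 'd"
  assumes "polytope P"
    and "aff_dim P = int CARD('d)"
    and "u \<in> sphere 0 1"
  shows "\<exists>r. partial_order_on (vertices_edges P u) r \<and>
           (\<forall>H. (\<exists>c. H = {x. u \<bullet> x = c}) \<and> H \<inter> P \<noteq> {} \<longrightarrow>
              maximal_antichain_on (vertices_edges P u) r
                {x \<in> vertices_edges P u. intersected H x})"
proof (intro exI conjI allI impI)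
  let ?A = "vertices_edges P u"
  let ?r = "{(x, y). x \<in> ?A \<and> y \<in> ?A \<and> (x = y \<or> interval_less u x y)}"
  show "partial_order_on ?A ?r"
    using heights_nonempty[OF assms(1)] by (rule partial_order_on_interval_order)
  fix H assume "(\<exists>c. H = {x. u \<bullet> x = c}) \<and> H \<inter> P \<noteq> {}"
  then obtain c p where H: "H = {x. u \<bullet> x = c}" and "p \<in> P" "u \<bullet> p = c"
    by blast
  then show "maximal_antichain_on ?A ?r {x \<in> ?A. intersected H x}"
    using intersected_elements_maximal_antichain[OF assms(1)]
    by (simp add: H intersected_iff_heights)
qed

end
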